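(* Let $\Omega$ be an infinite set, let $\kappa=\mathrm{cf}(|\Omega|)$, and suppose that $\Omega^\Omega$ is a semitopological semigroup with respect to some topology. Then there are either no isolated points or at least $2^{\kappa}$ isolated points in $\Omega^\Omega$. In particular, if $|\Omega|$ is regular, then there are either no isolated points or (exactly) $2^{|\Omega|}$ isolated points in $\Omega^\Omega$.
   Context: $\Omega^\Omega$ is the monoid of all functions $\Omega\to\Omega$ under composition. A semigroup $S$ with a topology is semitopological if for every $s\in S$ the maps $x\mapsto xs$ and $x\mapsto sx$ are continuous maps $S\to S$. A point $x$ is isolated if $\{x\}$ is open. The cofinality $\mathrm{cf}(\mu)$ of a cardinal $\mu$ is the least cardinal $\lambda$ such that $\mu$ is the union of $\lambda$ cardinals each smaller than $\mu$; $\mu$ is regular if $\mathrm{cf}(\mu)=\mu$. *)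

theory Defs
  imports "HOL-Analysis.Abstract_Topology" "HOL-Algebra.Group"
begin

unbundle cardinal_syntax

text \<open>
  Cardinals are elements of \<open>'a rel\<close> satisfying \<open>Card_order\<close>, compared by \<open>\<le>o\<close>, \<open><o\<close>, \<open>=o\<close>, as in
  \<open>BNF_Cardinal_Order_Relation\<close>; \<open>|A|\<close> is the cardinality of the set \<open>A\<close>.
\<close>

section \<open>Cofinality\<close>

text \<open>
  \<open>union_of_smaller l m\<close>: a set of size \<open>m\<close> is the union of \<open>l\<close> sets, each of cardinality
  smaller than \<open>m\<close>. The members are sets and not initial ordinals: read with initial ordinals,
  a union of cardinals smaller than a successor cardinal would never be that successor cardinal.
\<close>

definition union_of_smaller :: "'b rel \<Rightarrow> 'a rel \<Rightarrow> bool" where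
  "union_of_smaller l m \<longleftrightarrow>
     (\<exists>A. (\<Union>i\<in>Field l. A i) = Field m \<and> (\<forall>i\<in>Field l. |A i| <o m))"

definition is_cofinality :: "'a rel \<Rightarrow> 'a rel \<Rightarrow> bool" where
  "is_cofinality k m \<longleftrightarrow>
     Card_order k \<and> union_of_smaller k m \<and>
     (\<forall>l::'a rel. Card_order l \<and> union_of_smaller l m \<longrightarrow> k \<le>o l)"

text \<open>
  The least cardinal is determined up to \<open>=o\<close>. The lemmas below show that it exists for infinite
  \<open>m\<close>, and that restricting the competitors to the type of \<open>m\<close> is harmless.
\<close>

definition cf :: "'a rel \<Rightarrow> 'a rel" where
  "cf m = (SOME k. is_cofinality k m)"

definition regular_cardinal :: "'a rel \<Rightarrow> bool" where
  "regular_cardinal m \<longleftrightarrow> cf m =o m"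

lemma union_of_smaller_ordIso:
  fixes l :: "'b rel" and l' :: "'c rel"
  assumes "l =o l'" "Card_order l" "Card_order l'" "union_of_smaller l m"
  shows "union_of_smaller l' m"
proof -
  have "|Field l'| =o |Field l|"
    using ordIso_transitive[OF card_of_Field_ordIso[OF assms(3)]
        ordIso_transitive[OF ordIso_symmetric[OF assms(1)]
          ordIso_symmetric[OF card_of_Field_ordIso[OF assms(2)]]]] .
  then obtain f where f: "bij_betw f (Field l') (Field l)"
    using card_of_ordIso by blast
  obtain A where A: "(\<Union>i\<in>Field l. A i) = Field m" "\<forall>i\<in>Field l. |A i| <o m"
    using assms(4) unfolding union_of_smaller_def by blast
  have img: "f ` Field l' = Field l" using f by (rule bij_betw_imp_surj_on)
  have "(\<Union>i\<in>Field l'. A (f i)) = (\<Union>i\<in>f ` Field l'. A i)" by simp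
  then have "(\<Union>i\<in>Field l'. A (f i)) = Field m" using A(1) img by simp
  moreover have "\<forall>i\<in>Field l'. |A (f i)| <o m" using A(2) img by blast
  ultimately show ?thesis unfolding union_of_smaller_def by (intro exI[of _ "\<lambda>i. A (f i)"]) simp
qed

lemma union_of_smaller_self:
  fixes m :: "'a rel"
  assumes "Card_order m" "infinite (Field m)"
  shows "union_of_smaller m m"
  unfolding union_of_smaller_def
proof (intro exI[of _ "\<lambda>i. {i}"] conjI ballI)
  show "(\<Union>i\<in>Field m. {i}) = Field m" by simp
  show "|{i}| <o m" for i :: 'a
    using ordLess_ordIso_trans[OF finite_ordLess_infinite[OF card_of_Well_order card_of_Well_order]
        card_of_Field_ordIso[OF assms(1)], of "{i}"] assms(2) by (simp add: Field_card_of)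
qed

lemma is_cofinality_cf:
  fixes m :: "'a rel"
  assumes "Card_order m" "infinite (Field m)"
  shows "is_cofinality (cf m) m"
proof -
  let ?R = "{l::'a rel. Card_order l \<and> union_of_smaller l m}"
  have "?R \<noteq> {}" using assms union_of_smaller_self by blast
  then obtain k where "k \<in> ?R" "\<forall>l\<in>?R. k \<le>o l"
    using exists_minim_Card_order[of ?R] by blast
  then have "is_cofinality k m" unfolding is_cofinality_def by blast
  then show ?thesis unfolding cf_def by (rule someI)
qed

lemma cf_le_self:
  assumes "Card_order m" "infinite (Field m)"
  shows "cf m \<le>o m"
  using is_cofinality_cf[OF assms] union_of_smaller_self[OF assms] assms(1)
  unfolding is_cofinality_def by blast

lemma cf_least:
  fixes m :: "'a rel" and l :: "'b rel"
  assumes m: "Card_order m" "infinite (Field m)" and l: "Card_order l" "union_of_smaller l m"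
  shows "cf m \<le>o l"
proof (cases "m \<le>o l")
  case True
  then show ?thesis using cf_le_self[OF m] ordLeq_transitive by blast
next
  case False
  then have "l \<le>o m" using ordLeq_total m(1) l(1)
    unfolding card_order_on_def by blast
  then have "|Field l| \<le>o |Field m|" using card_of_mono2 by blast
  then obtain g :: "'b \<Rightarrow> 'a" where g: "inj_on g (Field l)"
    using card_of_ordLeq[of "Field l" "Field m"] by blast
  let ?l = "|g ` Field l|"
  have "|Field l| =o ?l" using card_of_ordIsoI[OF inj_on_imp_bij_betw[OF g]] .
  then have iso: "l =o ?l"
    by (rule ordIso_transitive[OF ordIso_symmetric[OF card_of_Field_ordIso[OF l(1)]]])
  have "union_of_smaller ?l m"
    using union_of_smaller_ordIso[OF iso l(1) card_of_Card_order l(2)] .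
  then have "cf m \<le>o ?l" using is_cofinality_cf[OF m] card_of_Card_order unfolding is_cofinality_def by blast
  then show ?thesis by (rule ordLeq_ordIso_trans[OF _ ordIso_symmetric[OF iso]])
qed

lemma regular_cardinal_iff_regularCard:
  assumes m: "Card_order m" "infinite (Field m)"
  shows "regular_cardinal m \<longleftrightarrow> regularCard m"
proof
  assume reg: "regular_cardinal m"
  show "regularCard m"
    unfolding regularCard_def
  proof (intro allI impI, elim conjE)
    fix K assume K: "K \<subseteq> Field m" "cofinal K m"
    have "(\<Union>k\<in>K. underS m k) = Field m"
      using K unfolding cofinal_def underS_def Field_def by blast
    moreover have "\<forall>k\<in>K. |underS m k| <o m"
      using K(1) card_of_underS[OF m(1)] by (simp add: subset_iff)
    ultimately have "union_of_smaller (card_of K) m"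
      unfolding union_of_smaller_def by (intro exI[of _ "underS m"]) (simp add: Field_card_of)
    then have "cf m \<le>o |K|" by (rule cf_least[OF m card_of_Card_order])
    then have "m \<le>o |K|"
      by (rule ordIso_ordLeq_trans[OF ordIso_symmetric[OF reg[unfolded regular_cardinal_def]]])
    moreover have "|K| \<le>o m"
      by (rule ordLeq_ordIso_trans[OF card_of_mono1[OF K(1)] card_of_Field_ordIso[OF m(1)]])
    ultimately show "|K| =o m" by (simp add: ordIso_iff_ordLeq)
  qed
next
  assume reg: "regularCard m"
  have k: "Card_order (cf m)" "union_of_smaller (cf m) m"
    using is_cofinality_cf[OF m] unfolding is_cofinality_def by blast+
  obtain A where A: "(\<Union>i\<in>Field (cf m). A i) = Field m" "\<forall>i\<in>Field (cf m). |A i| <o m"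
    using k(2) unfolding union_of_smaller_def by blast
  have "\<not> cf m <o m"
  proof
    assume "cf m <o m"
    then have "|Field (cf m)| <o m"
      by (rule ordIso_ordLess_trans[OF card_of_Field_ordIso[OF k(1)]])
    then have "|\<Union>i\<in>Field (cf m). A i| <o m"
      using card_of_UNION_ordLess_infinite_Field_regularCard[OF reg _ _ A(2)] m
      unfolding cinfinite_def by blast
    then have "|Field m| <o m" unfolding A(1) .
    then show False using card_of_Field_ordIso[OF m(1)] not_ordLess_ordIso by blast
  qed
  then show "regular_cardinal m"
    using cf_le_self[OF m] unfolding regular_cardinal_def ordLeq_iff_ordLess_or_ordIso by blast
qed

section \<open>Semitopological semigroups and full transformation monoids\<close>

text \<open>Only the carrier and the multiplication of \<open>S\<close> are used.\<close>

definition semitopological_semigroup :: "('s, 'x) monoid_scheme \<Rightarrow> 's topology \<Rightarrow> bool" where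
  "semitopological_semigroup S T \<longleftrightarrow>
     (\<forall>x\<in>carrier S. \<forall>y\<in>carrier S. x \<otimes>\<^bsub>S\<^esub> y \<in> carrier S) \<and>
     (\<forall>x\<in>carrier S. \<forall>y\<in>carrier S. \<forall>z\<in>carrier S.
        (x \<otimes>\<^bsub>S\<^esub> y) \<otimes>\<^bsub>S\<^esub> z = x \<otimes>\<^bsub>S\<^esub> (y \<otimes>\<^bsub>S\<^esub> z)) \<and>
     topspace T = carrier S \<and>
     (\<forall>s\<in>carrier S. continuous_map T T (\<lambda>x. x \<otimes>\<^bsub>S\<^esub> s) \<and> continuous_map T T (\<lambda>x. s \<otimes>\<^bsub>S\<^esub> x))"

definition isolated_points :: "'s topology \<Rightarrow> 's set" where
  "isolated_points T = {x \<in> topspace T. openin T {x}}"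

text \<open>As in \<open>HOL-Algebra.Bij\<close>, functions on \<open>\<Omega>\<close> are represented by extensional functions.\<close>

definition full_transformation_monoid :: "'a set \<Rightarrow> ('a \<Rightarrow> 'a) monoid" where
  "full_transformation_monoid \<Omega> =
     \<lparr>carrier = \<Omega> \<rightarrow>\<^sub>E \<Omega>, monoid.mult = \<lambda>f g. compose \<Omega> f g, one = (\<lambda>x\<in>\<Omega>. x)\<rparr>"

lemma monoid_full_transformation_monoid: "Group.monoid (full_transformation_monoid \<Omega>)"
  by (rule monoidI) (auto simp: full_transformation_monoid_def compose_def PiE_iff fun_eq_iff
      extensional_def restrict_def Pi_iff)

end

theory Submission
  imports Defs
begin

text \<open>
  The bound \<open>2 ^ |\<Omega>|\<close> holds for singular \<open>|\<Omega>|\<close> as well. Let \<open>f\<close> be isolated, and take a maximal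
  set \<open>M\<close> of pairwise disjoint pairs \<open>(a, b)\<close> with \<open>f a \<noteq> f b\<close>. Multiplying \<open>f\<close> on the right by a
  permutation gives an isolated point, so if \<open>|M| = |\<Omega>|\<close>, swapping the two entries of the pairs in the
  subsets of \<open>M\<close> yields \<open>2 ^ |\<Omega>|\<close> isolated points. Otherwise, by maximality, \<open>f\<close> has a constant value
  \<open>c\<close> outside a set of size less than \<open>|\<Omega>|\<close>, so some \<open>d\<close> is not a value of \<open>f\<close>. If \<open>f\<close> is isolated
  and \<open>A\<close> meets every fibre of \<open>f\<close>, then the set of all \<open>x\<close> that agree with \<open>f\<close> on \<open>A\<close> is open, being
  the preimage of \<open>{f}\<close> under right multiplication by a retraction onto \<open>A\<close>. Intersecting such sets for
  \<open>f\<close> and \<open>(c d) f\<close> shows that every function obtained from \<open>f\<close> by replacing the value \<open>c\<close> by \<open>d\<close> on a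
  nonempty proper subset of the fibre of \<open>c\<close> is isolated.
\<close>

section \<open>Cardinal arithmetic\<close>

lemma card_diff_ordLess_infinite:
  assumes "infinite A" "|B| <o |A|"
  shows "|A| \<le>o |A - B|"
proof (rule ccontr)
  assume "\<not> |A| \<le>o |A - B|"
  then have "|A - B| <o |A|" by (simp add: not_ordLeq_iff_ordLess card_of_Well_order)
  then have "|(A - B) \<union> B| <o |A|"
    using assms by (intro card_of_Un_ordLess_infinite)
  moreover have "|A| \<le>o |(A - B) \<union> B|" by (intro card_of_mono1) auto
  ultimately show False using not_ordLess_ordLeq by blast
qed

lemma card_Pow_mono: "|A| \<le>o |B| \<Longrightarrow> |Pow A| \<le>o |Pow B|"
proof -
  assume "|A| \<le>o |B|"
  then obtain f where "inj_on f A" "f ` A \<subseteq> B" unfolding card_of_ordLeq[symmetric] by blast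
  then have "inj_on ((`) f) (Pow A)" "(`) f ` Pow A \<subseteq> Pow B"
    by (auto simp: inj_on_image_Pow)
  then show ?thesis unfolding card_of_ordLeq[symmetric] by blast
qed

lemma ordLess_finite_infinite: "finite A \<Longrightarrow> infinite B \<Longrightarrow> |A| <o |B|"
  using finite_ordLess_infinite[OF card_of_Well_order card_of_Well_order] by (simp add: Field_card_of)

lemma card_Pow_ordIso_cexp: "|Pow A| =o ctwo ^c |A|"
  unfolding cexp_def ctwo_def Field_card_of by (rule card_of_Pow_Func)

lemma cexp_cf_le:
  fixes m :: "'a rel"
  assumes m: "Card_order m" "infinite (Field m)"
  shows "ctwo ^c cf m \<le>o ctwo ^c m"
proof (rule cexp_mono2'[OF cf_le_self[OF m] Card_order_ctwo])
  \<comment> \<open>Side condition of \<open>cexp_mono2'\<close>: a union over an empty index set is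
    empty, and by \<open>union_of_smaller\<close> it is \<open>Field m\<close>.\<close>
  assume "Field (cf m) = {}"
  then show "Field m = {}"
    using is_cofinality_cf[OF m] by (auto simp: is_cofinality_def union_of_smaller_def)
qed

section \<open>Disjoint pairs separated by a function\<close>

definition discordant_pairs :: "'a set \<Rightarrow> ('a \<Rightarrow> 'b) \<Rightarrow> ('a \<times> 'a) set \<Rightarrow> bool" where
  "discordant_pairs \<Omega> f M \<longleftrightarrow> M \<subseteq> \<Omega> \<times> \<Omega> \<and> (\<forall>(a, b)\<in>M. f a \<noteq> f b) \<and>
     (\<forall>p\<in>M. \<forall>q\<in>M. p \<noteq> q \<longrightarrow> {fst p, snd p} \<inter> {fst q, snd q} = {})"

text \<open>Zorn's lemma applies because any two pairs in the union of a chain already lie in one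
  member of the chain. Two uncovered points with different values would form a pair that enlarges a
  maximal family.\<close>

lemma discordant_pairs_maximal:
  obtains M where "discordant_pairs \<Omega> f M"
    "\<And>x y. x \<in> \<Omega> - (fst ` M \<union> snd ` M) \<Longrightarrow> y \<in> \<Omega> - (fst ` M \<union> snd ` M) \<Longrightarrow> f x = f y"
proof -
  have "\<Union>C \<in> Collect (discordant_pairs \<Omega> f)"
    if C: "subset.chain (Collect (discordant_pairs \<Omega> f)) C" for C
  proof -
    have el: "discordant_pairs \<Omega> f X" if "X \<in> C" for X
      using C that by (auto simp: subset.chain_def)
    have ch: "X \<subseteq> Y \<or> Y \<subseteq> X" if "X \<in> C" "Y \<in> C" for X Y
      using C that by (auto simp: subset_chain_def)
    have "{fst p, snd p} \<inter> {fst q, snd q} = {}" if pq: "p \<in> \<Union>C" "q \<in> \<Union>C" "p \<noteq> q" for p q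
    proof -
      obtain X Y where XY: "X \<in> C" "p \<in> X" "Y \<in> C" "q \<in> Y" using pq(1,2) by blast
      then have "\<exists>Z\<in>C. p \<in> Z \<and> q \<in> Z" using ch[of X Y] by blast
      then show ?thesis using el pq(3) unfolding discordant_pairs_def by meson
    qed
    moreover have "\<Union>C \<subseteq> \<Omega> \<times> \<Omega>" "\<forall>(a, b)\<in>\<Union>C. f a \<noteq> f b"
      using el unfolding discordant_pairs_def by blast+
    ultimately show ?thesis unfolding discordant_pairs_def mem_Collect_eq by blast
  qed
  then obtain M where M: "discordant_pairs \<Omega> f M"
    and mx: "\<And>X. discordant_pairs \<Omega> f X \<Longrightarrow> M \<subseteq> X \<Longrightarrow> X = M"
    using subset_Zorn'[of "Collect (discordant_pairs \<Omega> f)"] by auto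
  show thesis
  proof (rule that[OF M], rule ccontr)
    fix x y
    assume xy: "x \<in> \<Omega> - (fst ` M \<union> snd ` M)" "y \<in> \<Omega> - (fst ` M \<union> snd ` M)" "f x \<noteq> f y"
    have sep: "fst p \<noteq> x" "snd p \<noteq> x" "fst p \<noteq> y" "snd p \<noteq> y" if "p \<in> M" for p
      using xy(1,2) that by blast+
    have "{fst u, snd u} \<inter> {fst v, snd v} = {}"
      if uv: "u \<in> insert (x, y) M" "v \<in> insert (x, y) M" "u \<noteq> v" for u v
    proof -
      consider "u = (x, y)" "v \<in> M" | "u \<in> M" "v = (x, y)" | "u \<in> M" "v \<in> M" using uv by blast
      then show ?thesis
      proof cases
        case 1
        then show ?thesis using sep[of v] by auto
      next
        case 2
        then show ?thesis using sep[of u] by auto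
      next
        case 3
        then show ?thesis using M uv(3) unfolding discordant_pairs_def by meson
      qed
    qed
    moreover have "insert (x, y) M \<subseteq> \<Omega> \<times> \<Omega>" "\<forall>(a, b)\<in>insert (x, y) M. f a \<noteq> f b"
      using M xy unfolding discordant_pairs_def by auto
    ultimately have "discordant_pairs \<Omega> f (insert (x, y) M)"
      unfolding discordant_pairs_def by blast
    then have "insert (x, y) M = M" by (intro mx) auto
    then have "(x, y) \<in> M" by blast
    then show False using sep(1) by fastforce
  qed
qed

section \<open>The involution that swaps the entries of disjoint pairs\<close>

definition swap_pairs :: "('a \<times> 'a) set \<Rightarrow> 'a \<Rightarrow> 'a" where
  "swap_pairs S x = (if x \<in> Field S then THE y. (x, y) \<in> S \<union> S\<inverse> else x)"

lemma discordant_pairs_subset: "discordant_pairs \<Omega> f M \<Longrightarrow> S \<subseteq> M \<Longrightarrow> discordant_pairs \<Omega> f S"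
  unfolding discordant_pairs_def by blast

lemma swap_pairs_eq:
  assumes "discordant_pairs \<Omega> f S" "(a, b) \<in> S"
  shows "swap_pairs S a = b" "swap_pairs S b = a"
proof -
  have dis: "{a, b} \<inter> {x, y} = {}" if "(x, y) \<in> S" "(x, y) \<noteq> (a, b)" for x y
    using assms that unfolding discordant_pairs_def by (metis fst_conv snd_conv)
  have ne: "a \<noteq> b" using assms unfolding discordant_pairs_def by blast
  \<comment> \<open>For uniqueness, \<open>dis\<close> excludes partners coming from other pairs,
    and \<open>ne\<close> excludes reading \<open>(a, b)\<close> backwards.\<close>
  have "(THE y. (a, y) \<in> S \<union> S\<inverse>) = b" "(THE y. (b, y) \<in> S \<union> S\<inverse>) = a"
    using assms(2) dis ne by (intro the_equality; blast)+
  moreover have "a \<in> Field S" "b \<in> Field S" using assms(2) by (auto simp: Field_def)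
  ultimately show "swap_pairs S a = b" "swap_pairs S b = a" by (simp_all add: swap_pairs_def)
qed

lemma swap_pairs_involution:
  assumes "discordant_pairs \<Omega> f S"
  shows "swap_pairs S (swap_pairs S x) = x" "x \<in> \<Omega> \<Longrightarrow> swap_pairs S x \<in> \<Omega>"
proof -
  have "swap_pairs S (swap_pairs S x) = x \<and> (x \<in> \<Omega> \<longrightarrow> swap_pairs S x \<in> \<Omega>)"
  proof (cases "x \<in> Field S")
    case True
    then obtain y where "(x, y) \<in> S \<or> (y, x) \<in> S" by (auto simp: Field_def)
    moreover have "S \<subseteq> \<Omega> \<times> \<Omega>" using assms by (simp add: discordant_pairs_def)
    ultimately show ?thesis using swap_pairs_eq[OF assms] by auto
  qed (simp add: swap_pairs_def)
  then show "swap_pairs S (swap_pairs S x) = x" "x \<in> \<Omega> \<Longrightarrow> swap_pairs S x \<in> \<Omega>" by auto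
qed

text \<open>This makes \<open>S\<close> recoverable from \<open>f\<close> composed with the swap. A
  pair of \<open>M\<close> outside \<open>S\<close> is disjoint from all pairs of \<open>S\<close>,
  so its first entry stays fixed and keeps the value \<open>f a\<close>, which differs from
  \<open>f b\<close>.\<close>

lemma swap_pairs_fst_eq_iff:
  assumes M: "discordant_pairs \<Omega> f M" and S: "S \<subseteq> M" and ab: "(a, b) \<in> M"
  shows "f (swap_pairs S a) = f b \<longleftrightarrow> (a, b) \<in> S"
proof
  assume eq: "f (swap_pairs S a) = f b"
  show "(a, b) \<in> S"
  proof (rule ccontr)
    assume nS: "(a, b) \<notin> S"
    have "{a, b} \<inter> {fst p, snd p} = {}" if "p \<in> S" for p
      using M S ab nS that unfolding discordant_pairs_def by (metis fst_conv snd_conv subsetD)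
    then have "a \<notin> Field S" by (fastforce simp: Field_def)
    then have "f a = f b" using eq by (simp add: swap_pairs_def)
    then show False using M ab unfolding discordant_pairs_def by blast
  qed
next
  assume "(a, b) \<in> S"
  then show "f (swap_pairs S a) = f b"
    using swap_pairs_eq(1)[OF discordant_pairs_subset[OF M S]] by simp
qed

section \<open>Isolated points and open sets obtained by translation\<close>

locale semitopological_full_transformation_monoid =
  fixes \<Omega> :: "'a set" and T :: "('a \<Rightarrow> 'a) topology"
  assumes semitopological: "semitopological_semigroup (full_transformation_monoid \<Omega>) T"
begin

lemma topspace_eq: "topspace T = \<Omega> \<rightarrow>\<^sub>E \<Omega>"
  using semitopological
  by (simp add: semitopological_semigroup_def full_transformation_monoid_def)

lemma continuous_map_compose_right:
  "s \<in> \<Omega> \<rightarrow>\<^sub>E \<Omega> \<Longrightarrow> continuous_map T T (\<lambda>x. compose \<Omega> x s)"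
  using semitopological
  by (simp add: semitopological_semigroup_def full_transformation_monoid_def)

lemma continuous_map_compose_left:
  "s \<in> \<Omega> \<rightarrow>\<^sub>E \<Omega> \<Longrightarrow> continuous_map T T (\<lambda>x. compose \<Omega> s x)"
  using semitopological
  by (simp add: semitopological_semigroup_def full_transformation_monoid_def)

lemma isolated_points_iff: "f \<in> isolated_points T \<longleftrightarrow> f \<in> \<Omega> \<rightarrow>\<^sub>E \<Omega> \<and> openin T {f}"
  by (simp add: isolated_points_def topspace_eq)

text \<open>Multiplication by \<open>s\<close> on either side is its own inverse, so the open
  preimage of \<open>{f}\<close> is again a singleton, namely the corresponding product of
  \<open>f\<close> and \<open>s\<close>.\<close>

lemma isolated_compose_involution:
  assumes f: "f \<in> isolated_points T" and s: "s \<in> \<Omega> \<rightarrow>\<^sub>E \<Omega>" "\<And>x. x \<in> \<Omega> \<Longrightarrow> s (s x) = x"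
  shows "compose \<Omega> f s \<in> isolated_points T" "compose \<Omega> s f \<in> isolated_points T"
proof -
  have f': "f \<in> \<Omega> \<rightarrow>\<^sub>E \<Omega>" "openin T {f}"
    using f by (simp_all add: isolated_points_iff)
  have mem: "compose \<Omega> f s \<in> \<Omega> \<rightarrow>\<^sub>E \<Omega>" "compose \<Omega> s f \<in> \<Omega> \<rightarrow>\<^sub>E \<Omega>"
    using f'(1) s(1) by (auto simp: compose_def PiE_iff)
  have "{x \<in> topspace T. compose \<Omega> x s \<in> {f}} = {compose \<Omega> f s}" (is "?L = _")
  proof (intro equalityI subsetI)
    fix x assume "x \<in> ?L"
    then have x: "x \<in> \<Omega> \<rightarrow>\<^sub>E \<Omega>" "compose \<Omega> x s = f" by (auto simp: topspace_eq)
    have "compose \<Omega> f s = x"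
      using x(1) s by (intro extensionalityI[of _ \<Omega>]) (auto simp: x(2)[symmetric] compose_def PiE_iff)
    then show "x \<in> {compose \<Omega> f s}" by simp
  next
    fix x assume "x \<in> {compose \<Omega> f s}"
    moreover have "compose \<Omega> (compose \<Omega> f s) s = f"
      using f'(1) s by (intro extensionalityI[of _ \<Omega>]) (auto simp: compose_def PiE_iff)
    ultimately show "x \<in> ?L" using mem(1) by (simp add: topspace_eq)
  qed
  then show "compose \<Omega> f s \<in> isolated_points T"
    using openin_continuous_map_preimage[OF continuous_map_compose_right[OF s(1)] f'(2)] mem(1)
    by (simp add: isolated_points_iff)
  have "{x \<in> topspace T. compose \<Omega> s x \<in> {f}} = {compose \<Omega> s f}" (is "?L = _")
  proof (intro equalityI subsetI)
    fix x assume "x \<in> ?L"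
    then have x: "x \<in> \<Omega> \<rightarrow>\<^sub>E \<Omega>" "compose \<Omega> s x = f" by (auto simp: topspace_eq)
    have "compose \<Omega> s f = x"
      using x(1) s by (intro extensionalityI[of _ \<Omega>]) (auto simp: x(2)[symmetric] compose_def PiE_iff)
    then show "x \<in> {compose \<Omega> s f}" by simp
  next
    fix x assume "x \<in> {compose \<Omega> s f}"
    moreover have "compose \<Omega> s (compose \<Omega> s f) = f"
      using f'(1) s by (intro extensionalityI[of _ \<Omega>]) (auto simp: compose_def PiE_iff)
    ultimately show "x \<in> ?L" using mem(2) by (simp add: topspace_eq)
  qed
  then show "compose \<Omega> s f \<in> isolated_points T"
    using openin_continuous_map_preimage[OF continuous_map_compose_left[OF s(1)] f'(2)] mem(2)
    by (simp add: isolated_points_iff)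
qed

lemma openin_agree_on_transversal:
  assumes f: "f \<in> isolated_points T" and A: "A \<subseteq> \<Omega>" "f ` \<Omega> \<subseteq> f ` A"
  shows "openin T {x \<in> \<Omega> \<rightarrow>\<^sub>E \<Omega>. \<forall>a\<in>A. x a = f a}"
proof -
  have f': "f \<in> \<Omega> \<rightarrow>\<^sub>E \<Omega>" "openin T {f}"
    using f by (simp_all add: isolated_points_iff)
  \<comment> \<open>The choice \<open>r\<close> stays in each fibre of \<open>f\<close>, so
    agreement with \<open>f\<close> on \<open>A\<close> gives \<open>x (r a) = f a\<close> on all of
    \<Omega>. It fixes \<open>A\<close> pointwise, which gives the converse.\<close>
  have "\<forall>x\<in>\<Omega>. \<exists>a\<in>A. f a = f x \<and> (x \<in> A \<longrightarrow> a = x)"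
    using A(2) by (metis image_iff imageI subsetD)
  then obtain r where r: "\<And>x. x \<in> \<Omega> \<Longrightarrow> r x \<in> A \<and> f (r x) = f x \<and> (x \<in> A \<longrightarrow> r x = x)"
    by metis
  have t: "restrict r \<Omega> \<in> \<Omega> \<rightarrow>\<^sub>E \<Omega>"
    using r A(1) by auto
  have "compose \<Omega> x (restrict r \<Omega>) = f \<longleftrightarrow> (\<forall>a\<in>A. x a = f a)" if "x \<in> \<Omega> \<rightarrow>\<^sub>E \<Omega>" for x
  proof
    assume "compose \<Omega> x (restrict r \<Omega>) = f"
    then have "x (r a) = f a" if "a \<in> \<Omega>" for a
      using that by (auto simp: compose_def dest: fun_cong[of _ _ a])
    then show "\<forall>a\<in>A. x a = f a" using r A(1) by (metis subsetD)
  next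
    assume "\<forall>a\<in>A. x a = f a"
    then show "compose \<Omega> x (restrict r \<Omega>) = f"
      using f'(1) r by (intro extensionalityI[of _ \<Omega>]) (auto simp: compose_def PiE_iff)
  qed
  then have "{x \<in> topspace T. compose \<Omega> x (restrict r \<Omega>) \<in> {f}} = {x \<in> \<Omega> \<rightarrow>\<^sub>E \<Omega>. \<forall>a\<in>A. x a = f a}"
    by (auto simp: topspace_eq)
  then show ?thesis
    using openin_continuous_map_preimage[OF continuous_map_compose_right[OF t] f'(2)] by simp
qed

text \<open>The sets \<open>?A\<close> and \<open>?B\<close> cover \<Omega> and overlap exactly off
  the fibre of \<open>c\<close>, where \<open>f\<close> and its composite with the transposition
  agree. The points \<open>p\<close> and \<open>q\<close> ensure that each of the two sets still
  meets the fibre of \<open>c\<close>.\<close>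

lemma isolated_split_fibre:
  assumes f: "f \<in> isolated_points T" and cd: "c \<in> \<Omega>" "d \<in> \<Omega>" "d \<notin> f ` \<Omega>"
    and G: "p \<in> \<Omega>" "f p = c" "p \<in> G" and H: "q \<in> \<Omega>" "f q = c" "q \<notin> G"
  shows "(\<lambda>x\<in>\<Omega>. if f x = c \<and> x \<notin> G then d else f x) \<in> isolated_points T" (is "?g \<in> _")
proof -
  have f': "f \<in> \<Omega> \<rightarrow>\<^sub>E \<Omega>" using f by (simp add: isolated_points_iff)
  have g: "?g \<in> \<Omega> \<rightarrow>\<^sub>E \<Omega>" using f' cd(2) by auto
  \<comment> \<open>The transposition of \<open>c\<close> and \<open>d\<close>. Since
    \<open>d\<close> is not a value of \<open>f\<close>, composing with it only turns the value
    \<open>c\<close> into \<open>d\<close>.\<close>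
  define s where "s = (\<lambda>x\<in>\<Omega>. if x = c then d else if x = d then c else x)"
  have sf: "compose \<Omega> s f \<in> isolated_points T"
    using cd by (intro isolated_compose_involution(2)[OF f]) (auto simp: s_def)
  have sf_eq: "compose \<Omega> s f x = (if f x = c then d else f x)" if "x \<in> \<Omega>" for x
    using that f' cd(3) by (auto simp: compose_def s_def)
  let ?A = "{x \<in> \<Omega>. f x = c \<longrightarrow> x \<in> G}" and ?B = "{x \<in> \<Omega>. f x = c \<longrightarrow> x \<notin> G}"
  have "f ` \<Omega> \<subseteq> f ` ?A"
  proof
    fix y assume "y \<in> f ` \<Omega>"
    then obtain x where "x \<in> \<Omega>" "y = f x" by blast
    then show "y \<in> f ` ?A" using G by (cases "f x = c") force+
  qed
  then have A: "openin T {x \<in> \<Omega> \<rightarrow>\<^sub>E \<Omega>. \<forall>a\<in>?A. x a = f a}"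
    by (intro openin_agree_on_transversal[OF f]) auto
  have "compose \<Omega> s f ` \<Omega> \<subseteq> compose \<Omega> s f ` ?B"
  proof
    fix y assume "y \<in> compose \<Omega> s f ` \<Omega>"
    then obtain x where x: "x \<in> \<Omega>" "y = compose \<Omega> s f x" by blast
    show "y \<in> compose \<Omega> s f ` ?B"
    proof (cases "f x = c")
      case True
      then have "y = compose \<Omega> s f q" using x H sf_eq by simp
      then show ?thesis using H by blast
    qed (use x in blast)
  qed
  then have B: "openin T {x \<in> \<Omega> \<rightarrow>\<^sub>E \<Omega>. \<forall>a\<in>?B. x a = compose \<Omega> s f a}"
    by (intro openin_agree_on_transversal[OF sf]) auto
  have "{x \<in> \<Omega> \<rightarrow>\<^sub>E \<Omega>. \<forall>a\<in>?A. x a = f a} \<inter>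
      {x \<in> \<Omega> \<rightarrow>\<^sub>E \<Omega>. \<forall>a\<in>?B. x a = compose \<Omega> s f a} = {?g}" (is "?L = _")
  proof (intro equalityI subsetI)
    fix x assume "x \<in> ?L"
    then have "x \<in> \<Omega> \<rightarrow>\<^sub>E \<Omega>" "\<And>a. a \<in> ?A \<Longrightarrow> x a = f a" "\<And>a. a \<in> ?B \<Longrightarrow> x a = compose \<Omega> s f a"
      by auto
    then have "x = ?g"
      by (intro extensionalityI[of _ \<Omega>]) (auto simp: PiE_iff sf_eq)
    then show "x \<in> {?g}" by simp
  next
    fix x assume "x \<in> {?g}"
    then show "x \<in> ?L" using g by (auto simp: sf_eq)
  qed
  then show ?thesis
    using openin_Int[OF A B] g by (simp add: isolated_points_iff)
qed

section \<open>Counting isolated points\<close>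

lemma card_Pow_discordant_pairs_le:
  assumes f: "f \<in> isolated_points T" and M: "discordant_pairs \<Omega> f M"
  shows "|Pow M| \<le>o |isolated_points T|"
proof -
  let ?h = "\<lambda>S. compose \<Omega> f (restrict (swap_pairs S) \<Omega>)"
  have "inj_on ?h (Pow M)"
  proof (rule inj_onI)
    fix S S' assume S: "S \<in> Pow M" "S' \<in> Pow M" and eq: "?h S = ?h S'"
    \<comment> \<open>Membership of the pair is read off from the value of the product at
      \<open>a\<close>: it equals \<open>f b\<close> exactly for pairs in the swapped set.\<close>
    have "(a, b) \<in> S \<longleftrightarrow> (a, b) \<in> S'" if ab: "(a, b) \<in> M" for a b
    proof -
      have "a \<in> \<Omega>" using M ab by (auto simp: discordant_pairs_def)
      then have "f (swap_pairs S a) = f (swap_pairs S' a)"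
        using fun_cong[OF eq, of a] by (simp add: compose_def)
      then show ?thesis using swap_pairs_fst_eq_iff[OF M _ ab] S by (metis PowD)
    qed
    then show "S = S'" using S by (auto 0 3)
  qed
  moreover have "?h ` Pow M \<subseteq> isolated_points T"
  proof
    fix g assume "g \<in> ?h ` Pow M"
    then obtain S where S: "S \<subseteq> M" "g = ?h S" by blast
    note inv = swap_pairs_involution[OF discordant_pairs_subset[OF M S(1)]]
    show "g \<in> isolated_points T"
      unfolding S(2) by (intro isolated_compose_involution(1)[OF f]) (auto simp: inv)
  qed
  ultimately show ?thesis by (meson card_of_ordLeqI imageI subsetD)
qed

lemma card_Pow_fibre_le:
  assumes f: "f \<in> isolated_points T" and cd: "c \<in> \<Omega>" "d \<in> \<Omega>" "d \<notin> f ` \<Omega>"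
    and F: "F \<subseteq> {x \<in> \<Omega>. f x = c}" and pq: "p \<in> F" "q \<in> F" "p \<noteq> q"
  shows "|Pow (F - {p, q})| \<le>o |isolated_points T|"
proof -
  \<comment> \<open>The point \<open>p\<close> always keeps the value \<open>c\<close> and
    \<open>q\<close> always receives \<open>d\<close>, so both parts of the split fibre are nonempty
    for every \<open>S\<close>.\<close>
  let ?h = "\<lambda>S. \<lambda>x\<in>\<Omega>. if f x = c \<and> x \<notin> insert p S then d else f x"
  have cd': "c \<noteq> d" using cd(3) F pq(1) by blast
  have "inj_on ?h (Pow (F - {p, q}))"
  proof (rule inj_onI)
    fix S S' assume S: "S \<in> Pow (F - {p, q})" "S' \<in> Pow (F - {p, q})" and eq: "?h S = ?h S'"
    have "x \<in> S \<longleftrightarrow> x \<in> S'" if x: "x \<in> F - {p, q}" for x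
    proof -
      have "x \<in> \<Omega>" "f x = c" "x \<noteq> p" using x F by auto
      then show ?thesis using fun_cong[OF eq, of x] cd' by (simp split: if_splits)
    qed
    then show "S = S'" using S by auto
  qed
  moreover have "?h ` Pow (F - {p, q}) \<subseteq> isolated_points T"
  proof
    fix g assume "g \<in> ?h ` Pow (F - {p, q})"
    then obtain S where S: "S \<subseteq> F - {p, q}" "g = ?h S" by blast
    show "g \<in> isolated_points T"
      unfolding S(2) using F pq S(1) by (intro isolated_split_fibre[OF f cd, of p _ q]) auto
  qed
  ultimately show ?thesis by (meson card_of_ordLeqI imageI subsetD)
qed

lemma card_Pow_le_isolated_points:
  assumes inf: "infinite \<Omega>" and f: "f \<in> isolated_points T"
  shows "|Pow \<Omega>| \<le>o |isolated_points T|"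
proof -
  obtain M where M: "discordant_pairs \<Omega> f M"
    and const: "\<And>x y. x \<in> \<Omega> - (fst ` M \<union> snd ` M) \<Longrightarrow> y \<in> \<Omega> - (fst ` M \<union> snd ` M) \<Longrightarrow> f x = f y"
    using discordant_pairs_maximal[of \<Omega> f] by blast
  show ?thesis
  proof (cases "|\<Omega>| \<le>o |M|")
    case True
    then show ?thesis
      using ordLeq_transitive[OF card_Pow_mono card_Pow_discordant_pairs_le[OF f M]] by blast
  next
    case False
    then have lt: "|M| <o |\<Omega>|" by (simp add: not_ordLeq_iff_ordLess card_of_Well_order)
    define U where "U = fst ` M \<union> snd ` M"
    have U: "|U| <o |\<Omega>|"
      unfolding U_def
      using inf lt by (intro card_of_Un_ordLess_infinite) (auto intro: ordLeq_ordLess_trans[OF card_of_image])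
    define F where "F = \<Omega> - U"
    have F: "|\<Omega>| \<le>o |F|" unfolding F_def by (rule card_diff_ordLess_infinite[OF inf U])
    have infF: "infinite F" using card_of_ordLeq_infinite[OF F inf] .
    then obtain p where p: "p \<in> F" using infinite_imp_nonempty by blast
    obtain q where q: "q \<in> F" "q \<noteq> p"
      using infF by (metis finite.emptyI finite_insert insertCI subsetI rev_finite_subset)
    have f': "f \<in> \<Omega> \<rightarrow>\<^sub>E \<Omega>" using f by (simp add: isolated_points_iff)
    have c: "f p \<in> \<Omega>" using f' p by (auto simp: F_def)
    have Fc: "F \<subseteq> {x \<in> \<Omega>. f x = f p}"
      using const[of _ p] p unfolding F_def U_def by blast
    \<comment> \<open>All of \<open>F\<close> contributes the single value \<open>f p\<close>, so
      the image of \<open>f\<close> is too small to be \<Omega>. This provides the missing value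
      \<open>d\<close>.\<close>
    have "|{f p} \<union> f ` U| <o |\<Omega>|"
      by (rule card_of_Un_ordLess_infinite[OF inf ordLess_finite_infinite[OF _ inf]
            ordLeq_ordLess_trans[OF card_of_image U]]) simp
    moreover have "f ` \<Omega> \<subseteq> {f p} \<union> f ` U" using Fc by (auto simp: F_def)
    ultimately have "|f ` \<Omega>| <o |\<Omega>|" using ordLeq_ordLess_trans[OF card_of_mono1] by blast
    then have "\<not> \<Omega> \<subseteq> f ` \<Omega>" using card_of_mono1 not_ordLess_ordLeq by blast
    then obtain d where d: "d \<in> \<Omega>" "d \<notin> f ` \<Omega>" by blast
    \<comment> \<open>Reserving two points of the infinite set \<open>F\<close> does not lower its
      cardinality.\<close>
    have "|F| \<le>o |F - {p, q}|"
      by (intro card_diff_ordLess_infinite ordLess_finite_infinite infF) simp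
    with F have "|\<Omega>| \<le>o |F - {p, q}|" using ordLeq_transitive by blast
    then show ?thesis
      using ordLeq_transitive[OF card_Pow_mono card_Pow_fibre_le[OF f c d Fc p q(1)]] q(2) by blast
  qed
qed

text \<open>An extensional function is determined by its graph over \<Omega>, a subset of
  \<open>\<Omega> \<times> \<Omega>\<close>, and this square has the cardinality of
  \<Omega>.\<close>

lemma card_isolated_points_le_Pow:
  assumes inf: "infinite \<Omega>"
  shows "|isolated_points T| \<le>o |Pow \<Omega>|"
proof -
  let ?graph = "\<lambda>f. {(x, f x) |x. x \<in> \<Omega>}"
  have "inj_on ?graph (isolated_points T)"
  proof (rule inj_onI)
    fix f g assume fg: "f \<in> isolated_points T" "g \<in> isolated_points T" and eq: "?graph f = ?graph g"
    have "f x = g x" if "x \<in> \<Omega>" for x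
    proof -
      have "(x, f x) \<in> ?graph g" using that by (simp flip: eq)
      then show ?thesis by simp
    qed
    then show "f = g"
      using fg by (intro extensionalityI[of _ \<Omega>]) (auto simp: isolated_points_iff PiE_iff)
  qed
  moreover have "?graph ` isolated_points T \<subseteq> Pow (\<Omega> \<times> \<Omega>)"
    by (auto simp: isolated_points_iff)
  ultimately have "|isolated_points T| \<le>o |Pow (\<Omega> \<times> \<Omega>)|" using card_of_ordLeq by blast
  moreover have "|Pow (\<Omega> \<times> \<Omega>)| \<le>o |Pow \<Omega>|"
    using card_of_Times_same_infinite[OF inf] by (intro card_Pow_mono ordIso_imp_ordLeq)
  ultimately show ?thesis using ordLeq_transitive by blast
qed

end

theorem theorem4p4:
  fixes \<Omega> :: "'a set" and T :: "('a \<Rightarrow> 'a) topology"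
  assumes "infinite \<Omega>"
    and "semitopological_semigroup (full_transformation_monoid \<Omega>) T"
  shows "(isolated_points T = {} \<or> ctwo ^c cf |\<Omega>| \<le>o |isolated_points T| ) \<and>
    (regular_cardinal |\<Omega>| \<longrightarrow>
       isolated_points T = {} \<or> |isolated_points T| =o ctwo ^c |\<Omega>| )"
proof (cases "isolated_points T = {}")
  case False
  interpret semitopological_full_transformation_monoid \<Omega> T by unfold_locales (rule assms(2))
  have "|Pow \<Omega>| \<le>o |isolated_points T|"
    using False card_Pow_le_isolated_points[OF assms(1)] by blast
  with card_isolated_points_le_Pow[OF assms(1)] have "|isolated_points T| =o |Pow \<Omega>|"
    by (simp add: ordIso_iff_ordLeq)
  then have eq: "|isolated_points T| =o ctwo ^c |\<Omega>|"
    by (rule ordIso_transitive[OF _ card_Pow_ordIso_cexp])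
  \<comment> \<open>The bound with the cofinality follows from the exact count by monotonicity in
    the exponent.\<close>
  moreover have "ctwo ^c cf |\<Omega>| \<le>o ctwo ^c |\<Omega>|"
    using assms(1) by (intro cexp_cf_le card_of_Card_order) (simp add: Field_card_of)
  ultimately show ?thesis
    using ordLeq_ordIso_trans[OF _ ordIso_symmetric[OF eq]] by blast
qed simp

end
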